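(* Let $\mathcal{G}=(\mathcal{V},\mathcal{E})$ be a finite undirected graph without loops, with $\mathcal{V}=\mathcal{B}\cup\mathcal{I}$ partitioned into boundary nodes $\mathcal{B}$ and interior nodes $\mathcal{I}$. Let $\sigma'\in(0,\infty)^{\mathcal{E}}$, $\sigma''\in\mathbb{R}^{\mathcal{E}}$, $\omega_1\in\mathbb{R}\setminus\{0\}$, $\jmath=\sqrt{-1}$, and $N\ge1$. For $j=1,\ldots,N$ let $f_0^{(j)}\in\mathbb{R}^{\mathcal{B}}$, $f_1^{(j)}\in\mathbb{C}^{\mathcal{B}}$, and let $u_0^{(j)}\in\mathbb{R}^{\mathcal{V}}$, $u_1^{(j)}\in\mathbb{C}^{\mathcal{V}}$ satisfy $$[\nabla^T(\sigma'\odot\nabla u_0^{(j)})]_{\mathcal{I}}=0,\ [u_0^{(j)}]_{\mathcal{B}}=f_0^{(j)},\qquad [\nabla^T((\sigma'+\jmath\omega_1\sigma'')\odot\nabla u_1^{(j)})]_{\mathcal{I}}=0,\ [u_1^{(j)}]_{\mathcal{B}}=f_1^{(j)}.$$ Assume: (a) $\bigcup_{j=1}^N\operatorname{supp}\nabla u_0^{(j)}=\mathcal{E}$; (b) $[L_{\sigma'}]_{\mathcal{I}\mathcal{I}}$ is invertible; (c) for $j=1,\ldots,N$, $[L_{s^{(j)}\odot\sigma'}]_{\mathcal{I}\mathcal{I}}$ is invertible, where $s^{(j)}=1-2\,\mathbb{1}_{\operatorname{supp}\nabla u_0^{(j)}}$. Define for $j=1,\ldots,N$ the $|\mathcal{E}|\times|\mathcal{E}|$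 complex matrices $$A^{(j)}=-\jmath\,\operatorname{diag}(\overline{\nabla u_1^{(j)}})\,\nabla R_{\mathcal{I}}^T\,[L_{\sigma'+\jmath\omega_1\sigma''}]_{\mathcal{I}\mathcal{I}}^{-1}\,R_{\mathcal{I}}\nabla^T\operatorname{diag}(\nabla u_1^{(j)}).$$ If the $N|\mathcal{E}|\times|\mathcal{E}|$ real matrix $\operatorname{Re}([A^{(1)};\ldots;A^{(N)}])$ (vertical concatenation, entrywise real part) is full rank, i.e. has rank $|\mathcal{E}|$, then the linearization of the two-frequency inverse complex conductivity problem is injective. That is, if $\delta\sigma',\delta\sigma''\in\mathbb{R}^{\mathcal{E}}$, and $\delta u_0^{(j)}\in\mathbb{R}^{\mathcal{V}}$, $\delta u_1^{(j)}\in\mathbb{C}^{\mathcal{V}}$, $\delta\overline{u_1}^{(j)}\in\mathbb{C}^{\mathcal{V}}$ for $j=1,\ldots,N$ (with $\delta u_1^{(j)}$ and $\delta\overline{u_1}^{(j)}$ regarded as independent variables), satisfy for all $j=1,\ldots,N$ $$\delta\sigma'\odot|\nabla u_0^{(j)}|^2+2\sigma'\odot\nabla u_0^{(j)}\odot\nabla\delta u_0^{(j)}=0,$$ $$\delta\sigma'\odot|\nabla u_1^{(j)}|^2+\sigma'\odot\overline{\nabla u_1^{(j)}}\odot\nabla\delta u_1^{(j)}+\sigma'\odot\nabla u_1^{(j)}\odot\nabla\delta\overline{u_1}^{(j)}=0,$$ $$[\nabla^T(\delta\sigma'\odot\nabla u_0^{(j)})+\nabla^T(\sigma'\odot\nabla\delta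 u_0^{(j)})]_{\mathcal{I}}=0,$$ $$[\nabla^T((\delta\sigma'+\jmath\omega_1\delta\sigma'')\odot\nabla u_1^{(j)})+\nabla^T((\sigma'+\jmath\omega_1\sigma'')\odot\nabla\delta u_1^{(j)})]_{\mathcal{I}}=0,$$ $$[\nabla^T((\delta\sigma'-\jmath\omega_1\delta\sigma'')\odot\overline{\nabla u_1^{(j)}})+\nabla^T((\sigma'-\jmath\omega_1\sigma'')\odot\nabla\delta\overline{u_1}^{(j)})]_{\mathcal{I}}=0,$$ $$[\delta u_0^{(j)}]_{\mathcal{B}}=0,\quad[\delta u_1^{(j)}]_{\mathcal{B}}=0,\quad[\delta\overline{u_1}^{(j)}]_{\mathcal{B}}=0,$$ then $\delta\sigma'=0$, $\delta\sigma''=0$, and $\delta u_0^{(j)}=0$, $\delta u_1^{(j)}=0$, $\delta\overline{u_1}^{(j)}=0$ for all $j=1,\ldots,N$.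
   Context: For each edge $i\sim j$ an ordering of its endpoints is fixed once and for all. The discrete gradient $\nabla$ maps functions on $\mathcal{V}$ to functions on $\mathcal{E}$ by $(\nabla u)(i\sim j)=u(i)-u(j)$ (a real matrix), and $\nabla^T$ is its transpose. $\odot$ is the componentwise product; absolute values, squares and complex conjugates of vectors are componentwise. For $\tau\in\mathbb{C}^{\mathcal{E}}$, the discrete Laplacian is $L_\tau u=\nabla^T(\tau\odot\nabla u)$, viewed as a $|\mathcal{V}|\times|\mathcal{V}|$ matrix; $[L_\tau]_{\mathcal{I}\mathcal{I}}$ is its submatrix with rows and columns in $\mathcal{I}$. A subscript $\mathcal{I}$ or $\mathcal{B}$ on a vector denotes restriction. $R_{\mathcal{I}}$ is restriction of functions on $\mathcal{V}$ to $\mathcal{I}$, and $R_{\mathcal{I}}^T$ is extension by zero. $\operatorname{supp}g=\{x:g(x)\neq0\}$ and $\mathbb{1}_X$ is the indicator function of $X$. The two-frequency inverse complex conductivity problem is to find $(\sigma',\sigma'')$ and $(u_0^{(j)},u_1^{(j)},\overline{u_1}^{(j)})$, $j=1,\ldots,N$, from the dissipated power data $\sigma'\odot|\nabla u_0^{(j)}|^2$ and $\sigma'\odot|\nabla u_1^{(j)}|^2$ at frequencies $0$ and $\omega_1$, together with the Dirichlet problems at these two frequencies (and the complex conjugate of the one at $\omega_1$) with known boundary data; $u_1$ and $\overline{u_1}$ are treated as independent variables. The equations in the claim are its linearization with zero right-hand side. Under (b) and $\sigma'>0$ the matrix $[L_{\sigma'+\jmath\omega_1\sigma''}]_{\mathcal{I}\mathcal{I}}$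 is invertible, so $A^{(j)}$ is well defined. *)

theory Defs
  imports
    Complex_Main
    "HOL-Library.Indicator_Function"
    "Jordan_Normal_Form.DL_Rank"
    "Jordan_Normal_Form.DL_Submatrix"
    "Jordan_Normal_Form.Gauss_Jordan_Elimination"
begin

text \<open>
  A finite graph is encoded by its number \<open>n\<close> of nodes, with node set \<open>{..<n}\<close>, and the list
  \<open>es\<close> of its edges. Functions on the nodes are vectors of dimension \<open>n\<close>, functions on the edges
  are vectors of dimension \<open>length es\<close>. The pair \<open>(i, j)\<close> in \<open>es\<close> stands for the undirected edge
  between \<open>i\<close> and \<open>j\<close> together with the chosen ordering of its endpoints; distinctness is required
  of the unordered pairs, so that each undirected edge is listed once, with one ordering.
\<close>

definition simple_graph :: "nat \<Rightarrow> (nat \<times> nat) list \<Rightarrow> bool" where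
  "simple_graph n es \<longleftrightarrow>
     distinct (map (\<lambda>(i, j). {i, j}) es) \<and> (\<forall>(i, j) \<in> set es. i < n \<and> j < n \<and> i \<noteq> j)"

definition grad :: "nat \<Rightarrow> (nat \<times> nat) list \<Rightarrow> 'a::ring_1 mat" where
  "grad n es = mat (length es) n
     (\<lambda>(k, v). of_bool (v = fst (es ! k)) - of_bool (v = snd (es ! k)))"

definition hadamard :: "'a::times vec \<Rightarrow> 'a vec \<Rightarrow> 'a vec" (infixl "\<odot>\<^sub>v" 70) where
  "v \<odot>\<^sub>v w = vec (dim_vec v) (\<lambda>k. v $ k * w $ k)"

abbreviation cvec :: "real vec \<Rightarrow> complex vec" where
  "cvec \<equiv> map_vec complex_of_real"

abbreviation cnj_vec :: "complex vec \<Rightarrow> complex vec" where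
  "cnj_vec \<equiv> map_vec cnj"

definition abs_sq :: "'a::real_normed_vector vec \<Rightarrow> real vec" where
  "abs_sq v = map_vec (\<lambda>z. (norm z)\<^sup>2) v"

definition supp :: "'a::zero vec \<Rightarrow> nat set" where
  "supp v = {k. k < dim_vec v \<and> v $ k \<noteq> 0}"

definition diag :: "'a::zero vec \<Rightarrow> 'a mat" where
  "diag v = mat_diag (dim_vec v) (\<lambda>k. v $ k)"

definition laplacian :: "nat \<Rightarrow> (nat \<times> nat) list \<Rightarrow> 'a::comm_ring_1 vec \<Rightarrow> 'a mat" where
  "laplacian n es \<tau> = transpose_mat (grad n es) * diag \<tau> * grad n es"

text \<open>
  The matrix of the restriction to a set \<open>X\<close> of nodes, made of the rows of the identity matrix
  with index in \<open>X\<close>, in increasing order (the ordering used by \<^const>\<open>submatrix\<close>).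
\<close>

definition restr :: "nat \<Rightarrow> nat set \<Rightarrow> 'a::{zero,one} mat" where
  "restr n X = submatrix (1\<^sub>m n) X UNIV"

text \<open>The real and imaginary parts of the conductivity are \<open>a\<close> and \<open>\<omega> b\<close>.\<close>

definition conductivity :: "real \<Rightarrow> real vec \<Rightarrow> real vec \<Rightarrow> complex vec" where
  "conductivity \<omega> a b = cvec a + (\<i> * complex_of_real \<omega>) \<cdot>\<^sub>v cvec b"

definition sign_vec :: "real vec \<Rightarrow> real vec" where
  "sign_vec g = vec (dim_vec g) (\<lambda>k. 1 - 2 * indicator (supp g) k)"

text \<open>On square matrices, \<^const>\<open>mat_inverse\<close> returns \<^const>\<open>None\<close> exactly on the singular ones.\<close>

definition A_mat ::
    "nat \<Rightarrow> (nat \<times> nat) list \<Rightarrow> nat set \<Rightarrow> complex vec \<Rightarrow> complex vec \<Rightarrow> complex mat" where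
  "A_mat n es I \<tau> u =
     (- \<i>) \<cdot>\<^sub>m
       (diag (cnj_vec (grad n es *\<^sub>v u)) * grad n es * transpose_mat (restr n I)
        * the (mat_inverse (submatrix (laplacian n es \<tau>) I I))
        * restr n I * transpose_mat (grad n es) * diag (grad n es *\<^sub>v u))"

text \<open>Vertical concatenation of matrices with \<open>nc\<close> columns.\<close>

definition vstack :: "nat \<Rightarrow> 'a mat list \<Rightarrow> 'a mat" where
  "vstack nc Ms = mat_of_rows nc (concat (map rows Ms))"

end

theory Submission
  imports Defs
begin

text \<open>
  The perturbations decouple: the data at frequency zero determine \<open>\<delta>\<sigma>'\<close>, and the data at frequency \<open>\<omega>\<^sub>1\<close>
  then determine \<open>\<delta>\<sigma>''\<close>.

  At frequency zero, the linearized power equation allows \<open>\<delta>\<sigma>'\<close> to be eliminated from the linearized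
  Dirichlet problem. What remains is a homogeneous Dirichlet problem for \<open>\<delta>u\<^sub>0\<close> whose conductivity is \<open>\<sigma>'\<close>
  with its sign changed on the support of \<open>\<nabla>u\<^sub>0\<close>. This problem is uniquely solvable by (c), so
  \<open>\<delta>u\<^sub>0 = 0\<close> and \<open>\<delta>\<sigma>'\<close> vanishes where \<open>\<nabla>u\<^sub>0\<close> does not (\<open>zero_frequency_injective\<close>). By (a) these
  edges exhaust the graph.

  At frequency \<open>\<omega>\<^sub>1\<close>, the matrix \<open>[L]\<^sub>I\<^sub>I\<close> of the complex conductivity is invertible: its real part is
  coercive, by (b) and the positivity of \<open>\<sigma>'\<close> (\<open>dirichlet_unique_conductivity\<close>).
  With \<open>\<delta>\<sigma>' = 0\<close>, solving the linearized Dirichlet problem for \<open>\<delta>u\<^sub>1\<close> and multiplying its gradient by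
  the conjugate of \<open>\<nabla>u\<^sub>1\<close> yields exactly \<open>\<omega>\<^sub>1 A \<delta>\<sigma>''\<close>
  (\<open>A_mat_mult\<close>). The independent variable \<open>\<delta>u\<^sub>1_bar\<close> satisfies the conjugate problem, hence contributes
  the conjugate. The linearized power equation therefore says \<open>2 \<omega>\<^sub>1 Re (A) \<delta>\<sigma>'' = 0\<close> for every
  measurement (\<open>linearized_power_imp_Re_A_kernel\<close>), and the rank hypothesis gives \<open>\<delta>\<sigma>'' = 0\<close>. The remaining
  perturbations solve homogeneous Dirichlet problems and vanish.
\<close>

section \<open>Matrices acting on vectors\<close>

text \<open>
  The rank is the dimension of the span of the set of columns. If two columns coincide this set has fewer
  than \<open>nc\<close> elements, so full rank forces the columns to be distinct, and then independent.
\<close>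

lemma (in vec_space) full_column_rank_imp_trivial_kernel:
  assumes A: "A \<in> carrier_mat n nc" and rank: "rank A = nc"
    and v: "v \<in> carrier_vec nc" and Av: "A *\<^sub>v v = 0\<^sub>v n"
  shows "v = 0\<^sub>v nc"
proof (rule ccontr)
  assume nz: "v \<noteq> 0\<^sub>v nc"
  show False
  proof (cases "distinct (cols A)")
    case True
    then show False
      using full_rank_lin_indpt[OF A rank] lin_depI[OF A v nz Av] by blast
  next
    case False
    obtain S where S: "maximal S (\<lambda>T. T \<subseteq> set (cols A) \<and> lin_indpt T)"
      using maximal_exists[of "(\<lambda>T. T \<subseteq> set (cols A) \<and> lin_indpt T)" "card (set (cols A))" "{}"]
      by (meson List.finite_set card_mono empty_iff empty_subsetI finite_lin_indpt2 rev_finite_subset)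
    then have "card S \<le> card (set (cols A))"
      by (simp add: card_mono maximal_def)
    also have "\<dots> < nc"
      using False A card_distinct[of "cols A"] card_length[of "cols A"] cols_length[of A]
      by (metis carrier_matD(2) le_neq_implies_less)
    finally show False
      using rank rank_card_indpt[OF A S] by simp
  qed
qed

lemma invertible_mat_imp_trivial_kernel:
  fixes M :: "'a::field mat"
  assumes M: "M \<in> carrier_mat k k" and inv: "invertible_mat M"
    and v: "v \<in> carrier_vec k" and Mv: "M *\<^sub>v v = 0\<^sub>v k"
  shows "v = 0\<^sub>v k"
proof -
  obtain N where N: "inverts_mat N M" "inverts_mat M N"
    using inv unfolding invertible_mat_def by blast
  have NM: "N * M = 1\<^sub>m (dim_row N)" and MN: "M * N = 1\<^sub>m k"
    using N M unfolding inverts_mat_def by auto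
  have "dim_col N = k" "dim_row N = k"
    using arg_cong[OF NM, of dim_col] arg_cong[OF MN, of dim_col] M by auto
  then have N: "N \<in> carrier_mat k k" by auto
  have "v = (N * M) *\<^sub>v v" using NM N v by auto
  also have "\<dots> = N *\<^sub>v (M *\<^sub>v v)" using N M v by auto
  finally show ?thesis using Mv N by auto
qed

lemma mat_inverse_of_trivial_kernel:
  fixes M :: "'a::field mat"
  assumes M: "M \<in> carrier_mat k k"
    and ker: "\<And>v. v \<in> carrier_vec k \<Longrightarrow> M *\<^sub>v v = 0\<^sub>v k \<Longrightarrow> v = 0\<^sub>v k"
  shows "the (mat_inverse M) \<in> carrier_mat k k" "the (mat_inverse M) * M = 1\<^sub>m k"
proof -
  have "det M \<noteq> 0"
    using det_0_iff_vec_prod_zero_field[OF M] ker by blast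
  then have "M \<in> Units (ring_mat TYPE('a) k ())"
    using det_non_zero_imp_unit[OF M] by simp
  then obtain N where "mat_inverse M = Some N"
    using mat_inverse(1)[OF M, where b = "()"] by (cases "mat_inverse M") auto
  then show "the (mat_inverse M) \<in> carrier_mat k k" "the (mat_inverse M) * M = 1\<^sub>m k"
    using mat_inverse(2)[OF M] by auto
qed

lemma mult_mat_mult_vec:
  fixes v :: "'a::comm_ring_1 vec"
  assumes "dim_col A = dim_row B" "dim_col B = dim_vec v"
  shows "(A * B) *\<^sub>v v = A *\<^sub>v (B *\<^sub>v v)"
  using assms by (intro assoc_mult_mat_vec[of _ "dim_row A" "dim_row B" _ "dim_vec v"]) auto

lemma mult_mat_zero_vec:
  "dim_col A = k \<Longrightarrow> A *\<^sub>v 0\<^sub>v k = (0\<^sub>v (dim_row A) :: 'a::comm_ring_1 vec)"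
  by (intro eq_vecI) (simp_all add: scalar_prod_def)

lemma smult_mat_mult_vec:
  fixes v :: "'a::comm_ring_1 vec"
  shows "dim_col A = dim_vec v \<Longrightarrow> (c \<cdot>\<^sub>m A) *\<^sub>v v = c \<cdot>\<^sub>v (A *\<^sub>v v)"
  by (intro eq_vecI) (simp_all add: scalar_prod_def sum_distrib_left mult.assoc)

lemma mult_mat_uminus_vec:
  fixes v :: "'a::comm_ring_1 vec"
  shows "dim_col A = dim_vec v \<Longrightarrow> A *\<^sub>v (- v) = - (A *\<^sub>v v)"
  by (intro eq_vecI) (simp_all add: scalar_prod_def sum_negf)

lemma map_cnj_mult_mat_vec: "map_vec cnj (A *\<^sub>v v) = map_mat cnj A *\<^sub>v map_vec cnj v"
  if "dim_col A = dim_vec v"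
  using that by (intro eq_vecI) (simp_all add: scalar_prod_def)

lemma Re_mult_mat_vec:
  assumes "dim_col A = dim_vec v" "k < dim_row A"
  shows "(map_mat Re A *\<^sub>v v) $ k = Re ((A *\<^sub>v cvec v) $ k)"
  using assms by (simp add: scalar_prod_def)

lemma hadamard_dim [simp]: "dim_vec (v \<odot>\<^sub>v w) = dim_vec v"
  by (simp add: hadamard_def)

lemma hadamard_index [simp]: "k < dim_vec v \<Longrightarrow> (v \<odot>\<^sub>v w) $ k = v $ k * w $ k"
  by (simp add: hadamard_def)

lemma hadamard_carrier [simp]: "v \<in> carrier_vec m \<Longrightarrow> v \<odot>\<^sub>v w \<in> carrier_vec m"
  by (simp add: hadamard_def)

lemma diag_dim [simp]: "dim_row (diag v) = dim_vec v" "dim_col (diag v) = dim_vec v"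
  by (simp_all add: diag_def mat_diag_def)

lemma diag_mult_vec:
  fixes v w :: "'a::comm_ring_1 vec"
  assumes "dim_vec v = dim_vec w"
  shows "diag v *\<^sub>v w = v \<odot>\<^sub>v w"
proof (rule eq_vecI)
  fix k assume "k < dim_vec (v \<odot>\<^sub>v w)"
  then have k: "k < dim_vec v" by simp
  have "(diag v *\<^sub>v w) $ k = (\<Sum>l = 0..<dim_vec w. if l = k then v $ k * w $ l else 0)"
  proof -
    have "(diag v *\<^sub>v w) $ k = (\<Sum>l = 0..<dim_vec w. diag v $$ (k, l) * w $ l)"
      using k assms by (simp add: scalar_prod_def)
    also have "\<dots> = (\<Sum>l = 0..<dim_vec w. if l = k then v $ k * w $ l else 0)"
      using k assms by (intro sum.cong) (auto simp: diag_def mat_diag_def)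
    finally show ?thesis .
  qed
  also have "\<dots> = v $ k * w $ k" using k assms by simp
  finally show "(diag v *\<^sub>v w) $ k = (v \<odot>\<^sub>v w) $ k" using k by simp
qed simp

lemma vstack_carrier:
  assumes "\<forall>M\<in>set Ms. M \<in> carrier_mat m nc"
  shows "vstack nc Ms \<in> carrier_mat (length Ms * m) nc"
proof -
  have "length (concat (map rows Ms)) = length Ms * m"
    using assms by (induction Ms) auto
  then show ?thesis by (simp add: vstack_def carrier_matI)
qed

text \<open>
  Each row of the stacked matrix is a row of one of the blocks. The function \<open>f\<close> allows for the real
  part, which is taken after stacking.
\<close>

lemma vstack_kernel:
  fixes v :: "'b::comm_ring_1 vec"
  assumes M: "\<forall>M\<in>set Ms. M \<in> carrier_mat m nc"
    and z: "\<forall>M\<in>set Ms. map_mat f M *\<^sub>v v = 0\<^sub>v m"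
  shows "map_mat f (vstack nc Ms) *\<^sub>v v = 0\<^sub>v (length Ms * m)"
proof (rule eq_vecI)
  note S = vstack_carrier[OF M]
  show "dim_vec (map_mat f (vstack nc Ms) *\<^sub>v v) = dim_vec (0\<^sub>v (length Ms * m))"
    using S by simp
  fix i assume "i < dim_vec (0\<^sub>v (length Ms * m) :: 'b vec)"
  then have i: "i < length Ms * m" by simp
  let ?rs = "concat (map rows Ms)"
  have len: "length ?rs = length Ms * m"
    using carrier_matD(1)[OF S] by (simp only: vstack_def mat_of_rows_carrier(2))
  then have "?rs ! i \<in> set ?rs" using i by (metis nth_mem)
  then obtain M l where Ml: "M \<in> set Ms" "l < dim_row M" "?rs ! i = row M l"
    by (auto simp: rows_def)
  have Mc: "M \<in> carrier_mat m nc" using M Ml by blast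
  have "row (vstack nc Ms) i = row M l"
    unfolding vstack_def using len i Ml Mc by (subst mat_of_rows_row) auto
  moreover have "row (map_mat f (vstack nc Ms)) i = map_vec f (row (vstack nc Ms) i)"
    using S i by (intro eq_vecI) auto
  moreover have "row (map_mat f M) l = map_vec f (row M l)"
    using Ml by (intro eq_vecI) auto
  ultimately have "row (map_mat f (vstack nc Ms)) i = row (map_mat f M) l"
    by simp
  then have "(map_mat f (vstack nc Ms) *\<^sub>v v) $ i = (map_mat f M *\<^sub>v v) $ l"
    using S i Ml by simp
  also have "\<dots> = 0" using z Ml Mc by simp
  finally show "(map_mat f (vstack nc Ms) *\<^sub>v v) $ i = 0\<^sub>v (length Ms * m) $ i"
    using i by simp
qed

section \<open>Restriction to a set of nodes and extension by zero\<close>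

lemma restr_carrier [simp]:
  assumes "X \<subseteq> {..<n}"
  shows "restr n X \<in> carrier_mat (card X) n"
proof -
  have rows: "{i. i < n \<and> i \<in> X} = X" using assms by blast
  show ?thesis
    by (rule carrier_matI) (simp_all add: restr_def dim_submatrix rows)
qed

lemma restr_dim [simp]:
  assumes "X \<subseteq> {..<n}"
  shows "dim_row (restr n X) = card X" "dim_col (restr n X) = n"
  using restr_carrier[OF assms] by auto

lemma pick_mem:
  assumes "X \<subseteq> {..<n}" "i < card X"
  shows "pick X i \<in> X" "pick X i < n"
  using assms pick_in_set_le[of i X] by auto

lemma obtain_pick:
  assumes "X \<subseteq> {..<n}" "v \<in> X"
  obtains i where "i < card X" "pick X i = v"
proof
  have "finite X" using assms(1) finite_subset by blast
  then show "card {a \<in> X. a < v} < card X"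
    using assms(2) by (intro psubset_card_mono) auto
  show "pick X (card {a \<in> X. a < v}) = v"
    using pick_card_in_set[OF assms(2)] .
qed

lemma restr_index:
  assumes "X \<subseteq> {..<n}" "i < card X" "v < n"
  shows "restr n X $$ (i, v) = of_bool (pick X i = v)"
proof -
  have rows: "{i. i < n \<and> i \<in> X} = X" using assms by blast
  show ?thesis using assms pick_mem[OF assms(1,2)]
    by (simp add: restr_def submatrix_def pick_UNIV rows)
qed

lemma restr_mult_index:
  fixes x :: "'a::comm_ring_1 vec"
  assumes "X \<subseteq> {..<n}" "i < card X" "x \<in> carrier_vec n"
  shows "(restr n X *\<^sub>v x) $ i = x $ pick X i"
proof -
  let ?R = "restr n X :: 'a mat"
  have "(?R *\<^sub>v x) $ i = (\<Sum>v = 0..<n. if v = pick X i then x $ v else 0)"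
    using assms by (auto simp: scalar_prod_def restr_index intro!: sum.cong)
  also have "\<dots> = x $ pick X i"
    using pick_mem[OF assms(1,2)] by simp
  finally show ?thesis .
qed

lemma restr_eq_zero_iff:
  fixes x :: "'a::comm_ring_1 vec"
  assumes "X \<subseteq> {..<n}" "x \<in> carrier_vec n"
  shows "restr n X *\<^sub>v x = 0\<^sub>v (card X) \<longleftrightarrow> (\<forall>v\<in>X. x $ v = 0)"
proof
  assume z: "restr n X *\<^sub>v x = 0\<^sub>v (card X)"
  show "\<forall>v\<in>X. x $ v = 0"
  proof
    fix v assume "v \<in> X"
    then obtain i where "i < card X" "pick X i = v" using obtain_pick assms(1) by metis
    then show "x $ v = 0" using restr_mult_index[OF assms(1) _ assms(2), of i] z by simp
  qed
next
  assume "\<forall>v\<in>X. x $ v = 0"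
  moreover have "dim_vec (restr n X *\<^sub>v x) = card X"
    using restr_carrier[OF assms(1)] by (metis carrier_matD(1) dim_mult_mat_vec)
  ultimately show "restr n X *\<^sub>v x = 0\<^sub>v (card X)"
    using restr_mult_index[OF assms(1) _ assms(2)] pick_mem[OF assms(1)] by auto
qed

lemma extend_carrier:
  assumes "X \<subseteq> {..<n}"
  shows "transpose_mat (restr n X) *\<^sub>v y \<in> carrier_vec n"
  using assms by (intro carrier_vecI) simp

text \<open>
  The transpose of the restriction matrix is extension by zero.
\<close>

lemma extend_index:
  fixes y :: "'a::comm_ring_1 vec"
  assumes X: "X \<subseteq> {..<n}" and y: "y \<in> carrier_vec (card X)"
  shows "i < card X \<Longrightarrow> (transpose_mat (restr n X) *\<^sub>v y) $ pick X i = y $ i"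
    and "v < n \<Longrightarrow> v \<notin> X \<Longrightarrow> (transpose_mat (restr n X) *\<^sub>v y) $ v = 0"
proof -
  let ?R = "restr n X :: 'a mat"
  have sum: "(transpose_mat ?R *\<^sub>v y) $ v = (\<Sum>i = 0..<card X. if pick X i = v then y $ i else 0)"
    if v: "v < n" for v
  proof -
    have "(transpose_mat ?R *\<^sub>v y) $ v = (\<Sum>i = 0..<card X. ?R $$ (i, v) * y $ i)"
      using v X y by (simp add: scalar_prod_def)
    also have "\<dots> = (\<Sum>i = 0..<card X. if pick X i = v then y $ i else 0)"
      using v X by (intro sum.cong) (simp_all add: restr_index)
    finally show ?thesis .
  qed
  show "v < n \<Longrightarrow> v \<notin> X \<Longrightarrow> (transpose_mat ?R *\<^sub>v y) $ v = 0"
    using sum pick_mem[OF X] by (auto intro!: sum.neutral)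
  show "(transpose_mat ?R *\<^sub>v y) $ pick X i = y $ i" if i: "i < card X"
  proof -
    have "(transpose_mat ?R *\<^sub>v y) $ pick X i = (\<Sum>l = 0..<card X. if l = i then y $ l else 0)"
      unfolding sum[OF pick_mem(2)[OF X i]]
      using card_pick_le[of _ X] i by (intro sum.cong) (auto, metis)
    also have "\<dots> = y $ i" using i by simp
    finally show ?thesis .
  qed
qed

lemma restr_extend:
  fixes y :: "'a::comm_ring_1 vec"
  assumes X: "X \<subseteq> {..<n}" and y: "y \<in> carrier_vec (card X)"
  shows "restr n X *\<^sub>v (transpose_mat (restr n X) *\<^sub>v y) = y"
proof (rule eq_vecI)
  fix i assume "i < dim_vec y"
  then have "i < card X" using y by simp
  then show "(restr n X *\<^sub>v (transpose_mat (restr n X) *\<^sub>v y)) $ i = y $ i"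
    using restr_mult_index[OF X _ extend_carrier[OF X]] extend_index(1)[OF X y] by metis
qed (use X y in simp)

lemma extend_restr:
  fixes x :: "'a::comm_ring_1 vec"
  assumes X: "X \<subseteq> {..<n}" and x: "x \<in> carrier_vec n"
    and zero: "\<And>v. v < n \<Longrightarrow> v \<notin> X \<Longrightarrow> x $ v = 0"
  shows "transpose_mat (restr n X) *\<^sub>v (restr n X *\<^sub>v x) = x"
proof (rule eq_vecI)
  have Rx: "restr n X *\<^sub>v x \<in> carrier_vec (card X)"
    using restr_carrier[OF X] x by (metis mult_mat_vec_carrier)
  show "dim_vec (transpose_mat (restr n X) *\<^sub>v (restr n X *\<^sub>v x)) = dim_vec x"
    using extend_carrier[OF X] x by (metis carrier_vecD)
  fix v assume v: "v < dim_vec x"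
  show "(transpose_mat (restr n X) *\<^sub>v (restr n X *\<^sub>v x)) $ v = x $ v"
  proof (cases "v \<in> X")
    case True
    then obtain i where "i < card X" "pick X i = v" using obtain_pick X by metis
    then show ?thesis using extend_index(1)[OF X Rx] restr_mult_index[OF X _ x] by metis
  next
    case False
    then show ?thesis using extend_index(2)[OF X Rx] zero v x by (metis carrier_vecD)
  qed
qed

text \<open>
  This turns the entrywise definition of a principal submatrix into a composition of operators, so that
  \<open>[L]\<^sub>I\<^sub>I\<close> can be evaluated on restrictions of functions on all nodes.
\<close>

lemma submatrix_eq_restr:
  fixes M :: "'a::comm_ring_1 mat"
  assumes X: "X \<subseteq> {..<n}" and M: "M \<in> carrier_mat n n"
  shows "submatrix M X X = restr n X * M * transpose_mat (restr n X)"
proof (rule eq_matI)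
  have R: "(restr n X :: 'a mat) \<in> carrier_mat (card X) n" (is "?R \<in> _") using X by simp
  have c: "{i. i < n \<and> i \<in> X} = X" using X by blast
  show "dim_row (submatrix M X X) = dim_row (?R * M * transpose_mat ?R)"
    and "dim_col (submatrix M X X) = dim_col (?R * M * transpose_mat ?R)"
    using R M by (simp_all add: dim_submatrix c)
  fix i j assume "i < dim_row (?R * M * transpose_mat ?R)" "j < dim_col (?R * M * transpose_mat ?R)"
  then have i: "i < card X" and j: "j < card X" using R by auto
  note p = pick_mem[OF X i] pick_mem[OF X j]
  have RM: "(?R * M) $$ (i, v) = M $$ (pick X i, v)" if "v < n" for v
  proof -
    have "(?R * M) $$ (i, v) = (?R *\<^sub>v col M v) $ i" using R M i that by auto
    also have "\<dots> = col M v $ pick X i" using restr_mult_index[OF X i, of "col M v"] M by auto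
    finally show ?thesis using M that p by auto
  qed
  have rows: "row (?R * M) i \<in> carrier_vec n" "row ?R j \<in> carrier_vec n"
    using R M i j by (auto intro!: row_carrier_vec[of _ "card X"])
  have "(?R * M * transpose_mat ?R) $$ (i, j) = row (?R * M) i \<bullet> col (transpose_mat ?R) j"
    by (rule index_mult_mat(1)) (use R M i j in simp_all)
  also have "\<dots> = row ?R j \<bullet> row (?R * M) i"
    using comm_scalar_prod[OF rows] R j by (simp only: col_transpose carrier_matD)
  also have "\<dots> = (?R *\<^sub>v row (?R * M) i) $ j"
    by (rule index_mult_mat_vec[symmetric]) (use R j in simp)
  also have "\<dots> = row (?R * M) i $ pick X j"
    using restr_mult_index[OF X j rows(1)] .
  also have "\<dots> = M $$ (pick X i, pick X j)"
    using RM p R M i by auto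
  finally show "submatrix M X X $$ (i, j) = (?R * M * transpose_mat ?R) $$ (i, j)"
    using submatrix_index[of i M X j X] i j M by (simp add: c)
qed

section \<open>The discrete gradient\<close>

lemma grad_carrier [simp]: "grad n es \<in> carrier_mat (length es) n"
  by (simp add: grad_def)

lemma grad_dim [simp]: "dim_row (grad n es) = length es" "dim_col (grad n es) = n"
  by (simp_all add: grad_def)

lemma grad_mult_index:
  fixes u :: "'a::comm_ring_1 vec"
  assumes "simple_graph n es" "u \<in> carrier_vec n" "k < length es"
  shows "(grad n es *\<^sub>v u) $ k = u $ fst (es ! k) - u $ snd (es ! k)"
proof -
  have "es ! k \<in> set es" using assms(3) by simp
  then have "fst (es ! k) < n" "snd (es ! k) < n"
    using assms(1) by (auto simp: simple_graph_def)
  then have ends: "fst (es ! k) \<in> {0..<n}" "snd (es ! k) \<in> {0..<n}" by simp_all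
  have "(grad n es *\<^sub>v u) $ k = (\<Sum>v = 0..<n. (if v = fst (es ! k) then u $ v else 0)
      - (if v = snd (es ! k) then u $ v else 0))"
    using assms(2,3) by (auto simp: grad_def scalar_prod_def intro!: sum.cong)
  also have "\<dots> = u $ fst (es ! k) - u $ snd (es ! k)"
    using ends by (simp only: sum_subtractf sum.delta finite_atLeastLessThan if_True)
  finally show ?thesis .
qed

text \<open>
  The gradient has real entries \<open>0\<close>, \<open>1\<close>, \<open>-1\<close>, hence commutes with complex conjugation and with taking
  real or imaginary parts.
\<close>

lemma grad_map_vec:
  fixes x :: "'a::comm_ring_1 vec" and f :: "'a \<Rightarrow> 'b::comm_ring_1"
  assumes "simple_graph n es" "x \<in> carrier_vec n" "\<And>a b. f (a - b) = f a - f b"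
  shows "grad n es *\<^sub>v map_vec f x = map_vec f (grad n es *\<^sub>v x)"
proof (rule eq_vecI)
  fix k assume "k < dim_vec (map_vec f (grad n es *\<^sub>v x))"
  then have k: "k < length es" by simp
  then have "es ! k \<in> set es" by simp
  then have "fst (es ! k) < n" "snd (es ! k) < n"
    using assms(1) by (auto simp: simple_graph_def)
  then show "(grad n es *\<^sub>v map_vec f x) $ k = map_vec f (grad n es *\<^sub>v x) $ k"
    using k assms by (simp add: grad_mult_index del: index_mult_mat_vec)
qed simp

section \<open>Uniqueness for the discrete Dirichlet problem\<close>

abbreviation (input) net_current ::
    "nat \<Rightarrow> (nat \<times> nat) list \<Rightarrow> nat set \<Rightarrow> 'a::comm_ring_1 vec \<Rightarrow> 'a vec" where
  "net_current n es I w \<equiv> restr n I *\<^sub>v (transpose_mat (grad n es) *\<^sub>v w)"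

definition interior_supported :: "nat \<Rightarrow> nat set \<Rightarrow> 'a::zero vec \<Rightarrow> bool" where
  "interior_supported n I x \<longleftrightarrow> x \<in> carrier_vec n \<and> (\<forall>v<n. v \<notin> I \<longrightarrow> x $ v = 0)"

text \<open>
  Solutions with zero boundary data are the functions supported on the interior. Stating uniqueness for
  functions on all nodes, instead of invertibility of \<open>[L\<^sub>\<tau>]\<^sub>I\<^sub>I\<close>, makes real and complex problems directly
  comparable and keeps the enumeration of \<open>I\<close> out of the arguments.
\<close>

definition dirichlet_unique ::
    "nat \<Rightarrow> (nat \<times> nat) list \<Rightarrow> nat set \<Rightarrow> 'a::comm_ring_1 vec \<Rightarrow> bool" where
  "dirichlet_unique n es I \<tau> \<longleftrightarrow>
     (\<forall>x. interior_supported n I x \<longrightarrow>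
        net_current n es I (\<tau> \<odot>\<^sub>v (grad n es *\<^sub>v x)) = 0\<^sub>v (card I) \<longrightarrow> x = 0\<^sub>v n)"

lemma interior_supportedI:
  fixes x :: "'a::comm_ring_1 vec"
  assumes "B \<union> I = {..<n}" "x \<in> carrier_vec n" "restr n B *\<^sub>v x = 0\<^sub>v (card B)"
  shows "interior_supported n I x"
proof -
  have "B \<subseteq> {..<n}" using assms(1) by blast
  then have "\<forall>v\<in>B. x $ v = 0" using restr_eq_zero_iff assms(2,3) by blast
  then show ?thesis using assms(1,2) by (auto simp: interior_supported_def)
qed

lemma interior_supported_map_vec:
  assumes "interior_supported n I x" "f 0 = 0"
  shows "interior_supported n I (map_vec f x)"
  using assms by (auto simp: interior_supported_def)

lemma net_current_add:
  assumes "I \<subseteq> {..<n}" "v \<in> carrier_vec (length es)" "w \<in> carrier_vec (length es)"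
  shows "restr n I *\<^sub>v (transpose_mat (grad n es) *\<^sub>v v + transpose_mat (grad n es) *\<^sub>v w)
    = net_current n es I (v + w)"
  using mult_add_distrib_mat_vec[of "transpose_mat (grad n es)" n "length es" v w] assms by simp

lemma net_current_cnj:
  assumes I: "I \<subseteq> {..<n}" and w: "w \<in> carrier_vec (length es)"
  shows "net_current n es I (cnj_vec w) = cnj_vec (net_current n es I w)"
proof -
  have "map_mat cnj (transpose_mat (grad n es)) = transpose_mat (grad n es)"
    by (intro eq_matI) (simp_all add: grad_def of_bool_def)
  moreover have "map_mat cnj (restr n I) = restr n I"
    using I by (intro eq_matI) (simp_all add: restr_index of_bool_def)
  ultimately show ?thesis
    using I w by (simp add: map_cnj_mult_mat_vec)
qed

text \<open>
  The weak form of Kirchhoff's law: summation by parts moves the divergence onto the test function \<open>y\<close>;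
  the resulting terms vanish on the interior by the law and on the boundary because \<open>y\<close> does.
\<close>

lemma net_current_zero_imp_orthogonal:
  fixes w y :: "'a::comm_ring_1 vec"
  assumes I: "I \<subseteq> {..<n}" and w: "w \<in> carrier_vec (length es)"
    and z: "net_current n es I w = 0\<^sub>v (card I)" and y: "interior_supported n I y"
  shows "w \<bullet> (grad n es *\<^sub>v y) = 0"
proof -
  have yc: "y \<in> carrier_vec n" using y by (simp add: interior_supported_def)
  have wc: "transpose_mat (grad n es) *\<^sub>v w \<in> carrier_vec n"
    by (intro carrier_vecI) simp
  have "w \<bullet> (grad n es *\<^sub>v y) = (transpose_mat (grad n es) *\<^sub>v w) \<bullet> y"
    using transpose_vec_mult_scalar[OF grad_carrier yc w] by simp
  also have "\<dots> = 0"
    unfolding scalar_prod_def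
  proof (rule sum.neutral, rule ballI)
    fix v assume "v \<in> {0..<dim_vec y}"
    then have "v < n" using yc by simp
    then show "(transpose_mat (grad n es) *\<^sub>v w) $ v * y $ v = 0"
      using restr_eq_zero_iff[OF I wc] z y
      by (cases "v \<in> I") (simp_all add: interior_supported_def del: index_mult_mat_vec)
  qed
  finally show ?thesis .
qed

lemma laplacian_dim [simp]:
  "dim_row (laplacian n es \<tau>) = n" "dim_col (laplacian n es \<tau>) = n"
  by (simp_all add: laplacian_def)

lemma laplacian_carrier [simp]: "laplacian n es \<tau> \<in> carrier_mat n n"
  by (rule carrier_matI) simp_all

lemma submatrix_laplacian_carrier:
  assumes "I \<subseteq> {..<n}"
  shows "submatrix (laplacian n es \<tau>) I I \<in> carrier_mat (card I) (card I)"
  using assms by (intro carrier_matI) (simp_all add: submatrix_eq_restr[OF assms])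

lemma submatrix_laplacian_mult:
  fixes x \<tau> :: "'a::comm_ring_1 vec"
  assumes I: "I \<subseteq> {..<n}" and \<tau>: "\<tau> \<in> carrier_vec (length es)"
    and x: "interior_supported n I x"
  shows "submatrix (laplacian n es \<tau>) I I *\<^sub>v (restr n I *\<^sub>v x)
    = net_current n es I (\<tau> \<odot>\<^sub>v (grad n es *\<^sub>v x))"
proof -
  have xc: "x \<in> carrier_vec n" and ext: "transpose_mat (restr n I) *\<^sub>v (restr n I *\<^sub>v x) = x"
    using x extend_restr[OF I] by (auto simp: interior_supported_def)
  have "submatrix (laplacian n es \<tau>) I I *\<^sub>v (restr n I *\<^sub>v x)
      = restr n I *\<^sub>v (laplacian n es \<tau> *\<^sub>v x)"
    using I xc by (simp add: submatrix_eq_restr[OF I] mult_mat_mult_vec ext)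
  also have "laplacian n es \<tau> *\<^sub>v x
      = transpose_mat (grad n es) *\<^sub>v (\<tau> \<odot>\<^sub>v (grad n es *\<^sub>v x))"
    using \<tau> xc by (simp add: laplacian_def mult_mat_mult_vec diag_mult_vec)
  finally show ?thesis .
qed

lemma invertible_imp_dirichlet_unique:
  fixes \<tau> :: "'a::field vec"
  assumes I: "I \<subseteq> {..<n}" and \<tau>: "\<tau> \<in> carrier_vec (length es)"
    and inv: "invertible_mat (submatrix (laplacian n es \<tau>) I I)"
  shows "dirichlet_unique n es I \<tau>"
  unfolding dirichlet_unique_def
proof (intro allI impI)
  fix x :: "'a vec"
  assume x: "interior_supported n I x"
    and z: "net_current n es I (\<tau> \<odot>\<^sub>v (grad n es *\<^sub>v x)) = 0\<^sub>v (card I)"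
  have xc: "x \<in> carrier_vec n" using x by (simp add: interior_supported_def)
  have "restr n I *\<^sub>v x = 0\<^sub>v (card I)"
  proof (rule invertible_mat_imp_trivial_kernel[OF submatrix_laplacian_carrier[OF I] inv])
    show "restr n I *\<^sub>v x \<in> carrier_vec (card I)"
      using I by (intro carrier_vecI) simp
    show "submatrix (laplacian n es \<tau>) I I *\<^sub>v (restr n I *\<^sub>v x) = 0\<^sub>v (card I)"
      using submatrix_laplacian_mult[OF I \<tau> x] z by simp
  qed
  then have "\<forall>v\<in>I. x $ v = 0" using restr_eq_zero_iff[OF I xc] by blast
  then show "x = 0\<^sub>v n" using x by (intro eq_vecI) (auto simp: interior_supported_def)
qed

lemma dirichlet_unique_imp_trivial_kernel:
  fixes \<tau> :: "'a::comm_ring_1 vec"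
  assumes I: "I \<subseteq> {..<n}" and \<tau>: "\<tau> \<in> carrier_vec (length es)"
    and uniq: "dirichlet_unique n es I \<tau>"
    and y: "y \<in> carrier_vec (card I)"
    and z: "submatrix (laplacian n es \<tau>) I I *\<^sub>v y = 0\<^sub>v (card I)"
  shows "y = 0\<^sub>v (card I)"
proof -
  define x where "x = transpose_mat (restr n I) *\<^sub>v y"
  have x: "interior_supported n I x"
    using extend_carrier[OF I] extend_index(2)[OF I y] by (simp add: x_def interior_supported_def)
  have y_eq: "y = restr n I *\<^sub>v x"
    using restr_extend[OF I y] by (simp add: x_def)
  have "net_current n es I (\<tau> \<odot>\<^sub>v (grad n es *\<^sub>v x)) = 0\<^sub>v (card I)"
    using submatrix_laplacian_mult[OF I \<tau> x] z y_eq by simp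
  then have "x = 0\<^sub>v n" using uniq x by (simp add: dirichlet_unique_def)
  then show ?thesis
    using restr_eq_zero_iff[OF I, of "0\<^sub>v n"] I y_eq by auto
qed

lemma dirichlet_uniqueD:
  assumes "dirichlet_unique n es I \<tau>" "\<tau> \<in> carrier_vec (length es)" "interior_supported n I x"
    and "net_current n es I (0\<^sub>v (length es) \<odot>\<^sub>v g + \<tau> \<odot>\<^sub>v (grad n es *\<^sub>v x)) = 0\<^sub>v (card I)"
  shows "x = 0\<^sub>v n"
proof -
  have "0\<^sub>v (length es) \<odot>\<^sub>v g = 0\<^sub>v (length es)"
    by (intro eq_vecI) simp_all
  then have "net_current n es I (\<tau> \<odot>\<^sub>v (grad n es *\<^sub>v x)) = 0\<^sub>v (card I)"
    using assms(2,4) by simp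
  then show ?thesis using assms(1,3) by (simp add: dirichlet_unique_def)
qed

section \<open>Complex conductivities\<close>

lemma conductivity_dim [simp]:
  "dim_vec (conductivity \<omega> a b) = dim_vec b"
  by (simp add: conductivity_def)

lemma conductivity_index:
  assumes "a \<in> carrier_vec m" "b \<in> carrier_vec m" "k < m"
  shows "conductivity \<omega> a b $ k = complex_of_real (a $ k) + \<i> * (complex_of_real \<omega> * complex_of_real (b $ k))"
  using assms by (simp add: conductivity_def)

lemma conductivity_uminus:
  assumes "a \<in> carrier_vec m" "b \<in> carrier_vec m"
  shows "conductivity (- \<omega>) a b = cnj_vec (conductivity \<omega> a b)"
  using assms by (intro eq_vecI) (simp_all add: conductivity_def)

text \<open>
  Coercivity: testing the equation for \<open>x\<close> with the conjugate of \<open>x\<close> gives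
  \<open>\<Sum>\<^sub>k \<tau>\<^sub>k \<bar>(\<nabla>x)\<^sub>k\<bar>\<^sup>2 = 0\<close>, whose real part involves only the positive \<open>\<sigma>\<close>. Thus \<open>\<nabla>x = 0\<close>, so the real and
  imaginary parts of \<open>x\<close> solve the real problem for \<open>\<sigma>\<close> and vanish by uniqueness there.
\<close>

lemma dirichlet_unique_conductivity:
  assumes G: "simple_graph n es" and I: "I \<subseteq> {..<n}"
    and \<sigma>: "\<sigma> \<in> carrier_vec (length es)" "\<forall>k<length es. \<sigma> $ k > 0"
    and b: "b \<in> carrier_vec (length es)"
    and uniq: "dirichlet_unique n es I \<sigma>"
  shows "dirichlet_unique n es I (conductivity \<omega> \<sigma> b)"
  unfolding dirichlet_unique_def
proof (intro allI impI)
  fix x :: "complex vec"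
  let ?\<tau> = "conductivity \<omega> \<sigma> b"
  assume x: "interior_supported n I x"
    and z: "net_current n es I (?\<tau> \<odot>\<^sub>v (grad n es *\<^sub>v x)) = 0\<^sub>v (card I)"
  have xc: "x \<in> carrier_vec n" using x by (simp add: interior_supported_def)
  define g where "g = grad n es *\<^sub>v x"
  have gdim: "dim_vec g = length es" by (simp add: g_def)
  have \<tau>: "?\<tau> \<odot>\<^sub>v g \<in> carrier_vec (length es)" using b by (intro carrier_vecI) simp
  have "(?\<tau> \<odot>\<^sub>v g) \<bullet> cnj_vec g = 0"
    using net_current_zero_imp_orthogonal[OF I \<tau> z[folded g_def]
        interior_supported_map_vec[of n I x cnj, OF x]]
      grad_map_vec[OF G xc, of cnj]
    by (simp add: g_def)
  then have "(\<Sum>k = 0..<length es. ?\<tau> $ k * g $ k * cnj (g $ k)) = 0"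
    using b gdim by (simp add: scalar_prod_def)
  then have "(\<Sum>k = 0..<length es. Re (?\<tau> $ k * g $ k * cnj (g $ k))) = 0"
    by (simp only: Re_sum[symmetric] zero_complex.sel)
  also have "(\<Sum>k = 0..<length es. Re (?\<tau> $ k * g $ k * cnj (g $ k)))
      = (\<Sum>k = 0..<length es. \<sigma> $ k * (cmod (g $ k))\<^sup>2)"
    using \<sigma>(1) b
    by (intro sum.cong)
      (simp_all add: conductivity_index mult.assoc complex_mult_cnj cmod_power2)
  finally have "\<forall>k\<in>{0..<length es}. \<sigma> $ k * (cmod (g $ k))\<^sup>2 = 0"
    using \<sigma>(2) by (subst (asm) sum_nonneg_eq_0_iff) (auto simp: less_imp_le)
  then have g0: "g $ k = 0" if "k < length es" for k
    using \<sigma>(2) that by (metis atLeast0LessThan lessThan_iff less_irrefl mult_eq_0_iff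
        norm_eq_zero power_eq_0_iff)
  \<comment> \<open>applied to the real and to the imaginary part\<close>
  have part: "map_vec f x = 0\<^sub>v n"
    if f: "\<And>a b. f (a - b) = f a - f b" for f :: "complex \<Rightarrow> real"
  proof -
    have f0: "f 0 = 0" using f[of 0 0] by simp
    have "\<sigma> \<odot>\<^sub>v (grad n es *\<^sub>v map_vec f x) = 0\<^sub>v (length es)"
      using g0 gdim f0 \<sigma>(1) by (intro eq_vecI) (simp_all add: grad_map_vec[OF G xc f] flip: g_def)
    then have "net_current n es I (\<sigma> \<odot>\<^sub>v (grad n es *\<^sub>v map_vec f x)) = 0\<^sub>v (card I)"
      using I by (simp add: mult_mat_zero_vec)
    then show ?thesis
      using uniq interior_supported_map_vec[of n I x f, OF x f0] by (simp add: dirichlet_unique_def)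
  qed
  show "x = 0\<^sub>v n"
  proof (rule eq_vecI)
    fix v assume "v < dim_vec (0\<^sub>v n :: complex vec)"
    then have v: "v < n" by simp
    have "Re (x $ v) = 0" "Im (x $ v) = 0"
      using part[of Re] part[of Im] v xc by (metis index_map_vec(1) index_zero_vec(1) carrier_vecD minus_complex.sel)+
    then show "x $ v = 0\<^sub>v n $ v" using v by (simp add: complex_eq_iff)
  qed (use xc in simp)
qed

text \<open>
  The gradient and the restriction are real, so the equation can be conjugated. With \<open>\<delta>u\<^sub>1_bar\<close> for \<open>x\<close> this
  shows that the conjugate of \<open>\<delta>u\<^sub>1_bar\<close> satisfies the same equation as \<open>\<delta>u\<^sub>1\<close>.
\<close>

lemma net_current_conjugate_equation:
  assumes G: "simple_graph n es" and I: "I \<subseteq> {..<n}"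
    and carr: "a \<in> carrier_vec (length es)" "b \<in> carrier_vec (length es)"
      "a' \<in> carrier_vec (length es)" "b' \<in> carrier_vec (length es)"
    and x: "x \<in> carrier_vec n"
    and eq: "net_current n es I
      (conductivity (- \<omega>) a' b' \<odot>\<^sub>v cnj_vec (grad n es *\<^sub>v u)
        + conductivity (- \<omega>) a b \<odot>\<^sub>v (grad n es *\<^sub>v x)) = 0\<^sub>v (card I)"
  shows "net_current n es I
      (conductivity \<omega> a' b' \<odot>\<^sub>v (grad n es *\<^sub>v u)
        + conductivity \<omega> a b \<odot>\<^sub>v (grad n es *\<^sub>v cnj_vec x)) = 0\<^sub>v (card I)"
    (is "net_current n es I ?w = _")
proof -
  let ?w' = "conductivity (- \<omega>) a' b' \<odot>\<^sub>v cnj_vec (grad n es *\<^sub>v u)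
        + conductivity (- \<omega>) a b \<odot>\<^sub>v (grad n es *\<^sub>v x)"
  have "grad n es *\<^sub>v cnj_vec x = cnj_vec (grad n es *\<^sub>v x)"
    by (rule grad_map_vec[OF G x]) simp
  then have "?w = cnj_vec ?w'"
    using carr conductivity_uminus[OF carr(1,2), of \<omega>] conductivity_uminus[OF carr(3,4), of \<omega>]
    by (intro eq_vecI) (simp_all del: index_mult_mat_vec)
  moreover have "?w' \<in> carrier_vec (length es)"
    using carr by (intro carrier_vecI) simp
  ultimately show ?thesis
    using net_current_cnj[OF I, of ?w' es] eq by (auto simp del: index_mult_mat_vec)
qed

section \<open>The linearization at frequency zero\<close>

text \<open>
  On an edge where \<open>\<nabla>u \<noteq> 0\<close>, dividing the power equation by \<open>\<nabla>u\<close> gives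
  \<open>\<delta>\<sigma> \<nabla>u = - 2 \<sigma> \<nabla>x\<close>. Substituting this into the current \<open>\<delta>\<sigma> \<nabla>u + \<sigma> \<nabla>x\<close> replaces it by \<open>- \<sigma> \<nabla>x\<close> on
  these edges and by \<open>\<sigma> \<nabla>x\<close> on the others. So \<open>x\<close> solves the Dirichlet problem for \<open>\<sigma>\<close> with the signs
  flipped on the support of \<open>\<nabla>u\<close>, and the power equation then determines \<open>\<delta>\<sigma>\<close> there.
\<close>

lemma zero_frequency_injective:
  assumes I: "I \<subseteq> {..<n}"
    and \<sigma>: "\<sigma> \<in> carrier_vec (length es)"
    and \<delta>\<sigma>: "\<delta>\<sigma> \<in> carrier_vec (length es)"
    and x: "interior_supported n I x"
    and inv: "invertible_mat
      (submatrix (laplacian n es (sign_vec (grad n es *\<^sub>v u) \<odot>\<^sub>v \<sigma>)) I I)"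
    and data: "\<delta>\<sigma> \<odot>\<^sub>v abs_sq (grad n es *\<^sub>v u)
         + 2 \<cdot>\<^sub>v (\<sigma> \<odot>\<^sub>v (grad n es *\<^sub>v u) \<odot>\<^sub>v (grad n es *\<^sub>v x)) = 0\<^sub>v (length es)"
    and eq: "net_current n es I
      (\<delta>\<sigma> \<odot>\<^sub>v (grad n es *\<^sub>v u) + \<sigma> \<odot>\<^sub>v (grad n es *\<^sub>v x)) = 0\<^sub>v (card I)"
  shows "x = 0\<^sub>v n" "\<forall>k\<in>supp (grad n es *\<^sub>v u). \<delta>\<sigma> $ k = 0"
proof -
  define g h where "g = grad n es *\<^sub>v u" and "h = grad n es *\<^sub>v x"
  have dims: "dim_vec g = length es" "dim_vec h = length es" by (simp_all add: g_def h_def)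
  have trade: "\<delta>\<sigma> $ k * g $ k = - 2 * (\<sigma> $ k * h $ k)" if k: "k < length es" "g $ k \<noteq> 0" for k
  proof -
    have "g $ k * (\<delta>\<sigma> $ k * g $ k + 2 * (\<sigma> $ k * h $ k))
        = \<delta>\<sigma> $ k * (g $ k)\<^sup>2 + 2 * (\<sigma> $ k * g $ k * h $ k)"
      by (simp add: power2_eq_square algebra_simps)
    also have "\<dots> = (\<delta>\<sigma> \<odot>\<^sub>v abs_sq g + 2 \<cdot>\<^sub>v (\<sigma> \<odot>\<^sub>v g \<odot>\<^sub>v h)) $ k"
      using k(1) dims \<sigma> \<delta>\<sigma> by (simp add: abs_sq_def)
    also have "\<dots> = 0"
      unfolding data[folded g_def h_def] using k(1) by simp
    finally have "\<delta>\<sigma> $ k * g $ k + 2 * (\<sigma> $ k * h $ k) = 0"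
      using k(2) by (simp only: mult_eq_0_iff) blast
    then show ?thesis by linarith
  qed
  have flipped: "\<delta>\<sigma> \<odot>\<^sub>v g + \<sigma> \<odot>\<^sub>v h = (sign_vec g \<odot>\<^sub>v \<sigma>) \<odot>\<^sub>v h"
  proof (rule eq_vecI)
    fix k assume "k < dim_vec (sign_vec g \<odot>\<^sub>v \<sigma> \<odot>\<^sub>v h)"
    then have k: "k < length es" using dims by (simp add: sign_vec_def)
    have "sign_vec g $ k = (if g $ k = 0 then 1 else - 1)"
      using k dims by (simp add: sign_vec_def supp_def indicator_def)
    moreover have "\<delta>\<sigma> $ k * g $ k + \<sigma> $ k * h $ k
        = (if g $ k = 0 then 1 else - 1) * \<sigma> $ k * h $ k"
      using trade[OF k] by (cases "g $ k = 0") simp_all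
    ultimately show "(\<delta>\<sigma> \<odot>\<^sub>v g + \<sigma> \<odot>\<^sub>v h) $ k = (sign_vec g \<odot>\<^sub>v \<sigma> \<odot>\<^sub>v h) $ k"
      using k dims \<sigma> \<delta>\<sigma> by (simp add: sign_vec_def)
  qed (use dims \<sigma> in \<open>simp add: sign_vec_def\<close>)
  have "dirichlet_unique n es I (sign_vec g \<odot>\<^sub>v \<sigma>)"
  proof (rule invertible_imp_dirichlet_unique[OF I _ inv[folded g_def]])
    show "sign_vec g \<odot>\<^sub>v \<sigma> \<in> carrier_vec (length es)"
      using dims by (intro carrier_vecI) (simp add: sign_vec_def)
  qed
  then show x0: "x = 0\<^sub>v n"
    using x eq flipped by (simp add: dirichlet_unique_def g_def h_def)
  have "h $ k = 0" if "k < length es" for k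
    using that x0 by (simp add: h_def)
  then show "\<forall>k\<in>supp (grad n es *\<^sub>v u). \<delta>\<sigma> $ k = 0"
    using trade dims(1) unfolding supp_def g_def[symmetric] by auto
qed

section \<open>The linearization at a nonzero frequency\<close>

lemma A_mat_carrier: "A_mat n es I \<tau> u \<in> carrier_mat (length es) (length es)"
  by (rule carrier_matI) (simp_all add: A_mat_def)

text \<open>
  What \<open>A\<close> computes. The perturbation \<open>d\<close> of the conductivity injects the current \<open>\<nabla>\<^sup>T(d \<nabla>u)\<close> at the
  interior nodes, so \<open>x\<^sub>I = - [L\<^sub>\<tau>]\<^sub>I\<^sub>I\<inverse> (\<nabla>\<^sup>T(d \<nabla>u))\<^sub>I\<close>; applying \<open>diag (cnj \<nabla>u) \<nabla>\<close> to its extension by zero gives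
  \<open>A d\<close> up to the factor \<open>\<i>\<close>.
\<close>

lemma A_mat_mult:
  fixes u x d \<tau> :: "complex vec"
  assumes I: "I \<subseteq> {..<n}"
    and \<tau>: "\<tau> \<in> carrier_vec (length es)" and uniq: "dirichlet_unique n es I \<tau>"
    and d: "d \<in> carrier_vec (length es)" and x: "interior_supported n I x"
    and eq: "net_current n es I
      (d \<odot>\<^sub>v (grad n es *\<^sub>v u) + \<tau> \<odot>\<^sub>v (grad n es *\<^sub>v x)) = 0\<^sub>v (card I)"
  shows "A_mat n es I \<tau> u *\<^sub>v d
    = \<i> \<cdot>\<^sub>v (cnj_vec (grad n es *\<^sub>v u) \<odot>\<^sub>v (grad n es *\<^sub>v x))"
proof -
  let ?R = "restr n I :: complex mat" and ?G = "grad n es :: complex mat"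
  let ?L = "submatrix (laplacian n es \<tau>) I I"
  define g where "g = ?G *\<^sub>v u"
  have g: "dim_vec g = length es" by (simp add: g_def)
  have xc: "dim_vec x = n" and ext: "transpose_mat ?R *\<^sub>v (?R *\<^sub>v x) = x"
    using x extend_restr[OF I] by (auto simp: interior_supported_def)
  note L = submatrix_laplacian_carrier[OF I, of es \<tau>]
  note inv = mat_inverse_of_trivial_kernel[OF L
      dirichlet_unique_imp_trivial_kernel[OF I \<tau> uniq]]
  define H where "H = the (mat_inverse ?L)"
  have H: "H \<in> carrier_mat (card I) (card I)" and HL: "H * ?L = 1\<^sub>m (card I)"
    using inv by (auto simp: H_def)
  have Rx: "?R *\<^sub>v x \<in> carrier_vec (card I)" using I by (intro carrier_vecI) simp
  have "net_current n es I (d \<odot>\<^sub>v g) + ?L *\<^sub>v (?R *\<^sub>v x) = 0\<^sub>v (card I)"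
  proof -
    have div: "transpose_mat ?G *\<^sub>v w \<in> carrier_vec n" for w
      by (intro carrier_vecI) simp
    have "net_current n es I (d \<odot>\<^sub>v g) + net_current n es I (\<tau> \<odot>\<^sub>v (?G *\<^sub>v x))
        = net_current n es I (d \<odot>\<^sub>v g + \<tau> \<odot>\<^sub>v (?G *\<^sub>v x))"
      using mult_add_distrib_mat_vec[OF restr_carrier[OF I] div div]
        net_current_add[OF I, of "d \<odot>\<^sub>v g" es "\<tau> \<odot>\<^sub>v (?G *\<^sub>v x)"] d \<tau>
      by simp
    then show ?thesis
      using eq submatrix_laplacian_mult[OF I \<tau> x] by (simp add: g_def)
  qed
  then have current: "net_current n es I (d \<odot>\<^sub>v g) = - (?L *\<^sub>v (?R *\<^sub>v x))"
    using L I by (intro eq_vecI) (auto simp: vec_eq_iff add_eq_0_iff2 simp del: index_mult_mat_vec)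
  have "H *\<^sub>v net_current n es I (d \<odot>\<^sub>v g) = - (H *\<^sub>v (?L *\<^sub>v (?R *\<^sub>v x)))"
    unfolding current using H L by (intro mult_mat_uminus_vec) simp
  also have "H *\<^sub>v (?L *\<^sub>v (?R *\<^sub>v x)) = ?R *\<^sub>v x"
    using assoc_mult_mat_vec[OF H L Rx] HL Rx by simp
  finally have inverse: "H *\<^sub>v net_current n es I (d \<odot>\<^sub>v g) = - (?R *\<^sub>v x)" .
  have comm: "g \<odot>\<^sub>v d = d \<odot>\<^sub>v g"
    using d g by (intro eq_vecI) auto
  have "A_mat n es I \<tau> u *\<^sub>v d
      = (- \<i>) \<cdot>\<^sub>v (diag (cnj_vec g) *\<^sub>v (?G *\<^sub>v (transpose_mat ?R *\<^sub>v
          (H *\<^sub>v net_current n es I (diag g *\<^sub>v d)))))"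
    using I H d g
    by (simp add: A_mat_def mult_mat_mult_vec smult_mat_mult_vec
        flip: g_def H_def)
  also have "\<dots> = (- \<i>) \<cdot>\<^sub>v (- (cnj_vec g \<odot>\<^sub>v (?G *\<^sub>v x)))"
    using I d g xc by (simp add: diag_mult_vec comm inverse mult_mat_uminus_vec ext)
  also have "\<dots> = \<i> \<cdot>\<^sub>v (cnj_vec g \<odot>\<^sub>v (?G *\<^sub>v x))"
    using g by (intro eq_vecI) (simp_all del: index_mult_mat_vec)
  finally show ?thesis by (simp add: g_def)
qed

text \<open>
  Here \<open>x\<close> and \<open>x'\<close> are the perturbations of \<open>u\<close> and of its conjugate, and \<open>d = \<i>\<omega>b\<close> is the perturbation
  of the conductivity. Both \<open>x\<close> and the conjugate of \<open>x'\<close> are responses to \<open>d\<close>, so the two terms of the power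
  equation are \<open>\<sigma> \<omega> A b\<close> and its conjugate: their sum is \<open>2 \<sigma> \<omega> Re (A b)\<close>.
\<close>

lemma linearized_power_imp_Re_A_kernel:
  assumes G: "simple_graph n es" and I: "I \<subseteq> {..<n}"
    and \<sigma>: "\<sigma> \<in> carrier_vec (length es)" "\<forall>k<length es. \<sigma> $ k > 0"
    and \<tau>: "\<tau> \<in> carrier_vec (length es)" and uniq: "dirichlet_unique n es I \<tau>"
    and b: "b \<in> carrier_vec (length es)" and \<omega>: "\<omega> \<noteq> 0"
    and x: "interior_supported n I x" and x': "interior_supported n I x'"
    and eq: "net_current n es I (((\<i> * complex_of_real \<omega>) \<cdot>\<^sub>v cvec b) \<odot>\<^sub>v (grad n es *\<^sub>v u)
      + \<tau> \<odot>\<^sub>v (grad n es *\<^sub>v x)) = 0\<^sub>v (card I)"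
    and eq': "net_current n es I (((\<i> * complex_of_real \<omega>) \<cdot>\<^sub>v cvec b) \<odot>\<^sub>v (grad n es *\<^sub>v u)
      + \<tau> \<odot>\<^sub>v (grad n es *\<^sub>v cnj_vec x')) = 0\<^sub>v (card I)"
    and data: "cvec \<sigma> \<odot>\<^sub>v cnj_vec (grad n es *\<^sub>v u) \<odot>\<^sub>v (grad n es *\<^sub>v x)
      + cvec \<sigma> \<odot>\<^sub>v (grad n es *\<^sub>v u) \<odot>\<^sub>v (grad n es *\<^sub>v x') = 0\<^sub>v (length es)"
  shows "map_mat Re (A_mat n es I \<tau> u) *\<^sub>v b = 0\<^sub>v (length es)"
proof (rule eq_vecI)
  let ?A = "A_mat n es I \<tau> u"
  let ?d = "(\<i> * complex_of_real \<omega>) \<cdot>\<^sub>v cvec b"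
  have A: "dim_row ?A = length es" "dim_col ?A = length es"
    using A_mat_carrier[of n es I \<tau> u] by auto
  show "dim_vec (map_mat Re ?A *\<^sub>v b) = dim_vec (0\<^sub>v (length es))" using A by simp
  fix k assume "k < dim_vec (0\<^sub>v (length es) :: real vec)"
  then have k: "k < length es" by simp
  have d: "?d \<in> carrier_vec (length es)" using b by simp
  have x'c: "x' \<in> carrier_vec n" using x' by (simp add: interior_supported_def)
  define g h h' where "g = grad n es *\<^sub>v u" and "h = grad n es *\<^sub>v x" and "h' = grad n es *\<^sub>v x'"
  have dims: "dim_vec g = length es" "dim_vec h = length es" "dim_vec h' = length es"
    by (simp_all add: g_def h_def h'_def)
  have Ad: "?A *\<^sub>v ?d = (\<i> * complex_of_real \<omega>) \<cdot>\<^sub>v (?A *\<^sub>v cvec b)"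
    using A b by (intro eq_vecI) simp_all
  have "?A *\<^sub>v ?d = \<i> \<cdot>\<^sub>v (cnj_vec g \<odot>\<^sub>v h)"
    using A_mat_mult[OF I \<tau> uniq d x eq] by (simp only: g_def h_def)
  then have 1: "complex_of_real \<omega> * (?A *\<^sub>v cvec b) $ k = cnj (g $ k) * h $ k"
    unfolding Ad using k dims A by (auto simp: vec_eq_iff simp del: index_mult_mat_vec)
  have "?A *\<^sub>v ?d = \<i> \<cdot>\<^sub>v (cnj_vec g \<odot>\<^sub>v cnj_vec h')"
    using A_mat_mult[OF I \<tau> uniq d _ eq'] interior_supported_map_vec[of n I x' cnj, OF x']
      grad_map_vec[OF G x'c, of cnj]
    by (simp add: g_def h'_def)
  then have 2: "complex_of_real \<omega> * (?A *\<^sub>v cvec b) $ k = cnj (g $ k) * cnj (h' $ k)"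
    unfolding Ad using k dims A by (auto simp: vec_eq_iff simp del: index_mult_mat_vec)
  have "(cvec \<sigma> \<odot>\<^sub>v cnj_vec g \<odot>\<^sub>v h + cvec \<sigma> \<odot>\<^sub>v g \<odot>\<^sub>v h') $ k = 0"
    unfolding data[folded g_def h_def h'_def] using k by simp
  then have "complex_of_real (\<sigma> $ k) * (cnj (g $ k) * h $ k + g $ k * h' $ k) = 0"
    using k dims \<sigma>(1) by (simp add: distrib_left mult.assoc)
  then have "cnj (g $ k) * h $ k + cnj (cnj (g $ k) * cnj (h' $ k)) = 0"
    using \<sigma>(2) k by fastforce
  then have "Re (complex_of_real \<omega> * (?A *\<^sub>v cvec b) $ k) = 0"
    \<comment> \<open>a number plus its conjugate is twice its real part\<close>
    unfolding 1[symmetric] 2[symmetric] by (simp add: complex_eq_iff del: index_mult_mat_vec)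
  then have "Re ((?A *\<^sub>v cvec b) $ k) = 0" using \<omega> by (simp del: index_mult_mat_vec)
  then show "(map_mat Re ?A *\<^sub>v b) $ k = 0\<^sub>v (length es) $ k"
    using Re_mult_mat_vec[of ?A b k] A b k by (simp del: index_mult_mat_vec)
qed

section \<open>Injectivity of the linearized two-frequency problem\<close>

theorem theorem3:
  fixes n N :: nat and es :: "(nat \<times> nat) list" and B I :: "nat set"
    and \<sigma>' \<sigma>'' \<delta>\<sigma>' \<delta>\<sigma>'' :: "real vec" and \<omega>\<^sub>1 :: real
    and f\<^sub>0 u\<^sub>0 \<delta>u\<^sub>0 :: "nat \<Rightarrow> real vec"
    and f\<^sub>1 u\<^sub>1 \<delta>u\<^sub>1 \<delta>u\<^sub>1_bar :: "nat \<Rightarrow> complex vec"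
  assumes graph: "simple_graph n es"
    and partition: "B \<union> I = {..<n}" "B \<inter> I = {}"
    and \<sigma>': "\<sigma>' \<in> carrier_vec (length es)" "\<forall>k<length es. \<sigma>' $ k > 0"
    and \<sigma>'': "\<sigma>'' \<in> carrier_vec (length es)"
    and \<omega>\<^sub>1: "\<omega>\<^sub>1 \<noteq> 0"
    and N: "N \<ge> 1"
    and f\<^sub>0: "\<forall>j\<in>{1..N}. f\<^sub>0 j \<in> carrier_vec (card B)"
    and f\<^sub>1: "\<forall>j\<in>{1..N}. f\<^sub>1 j \<in> carrier_vec (card B)"
    and u\<^sub>0: "\<forall>j\<in>{1..N}. u\<^sub>0 j \<in> carrier_vec n"
      "\<forall>j\<in>{1..N}. restr n I *\<^sub>v (transpose_mat (grad n es) *\<^sub>v (\<sigma>' \<odot>\<^sub>v (grad n es *\<^sub>v u\<^sub>0 j)))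
         = 0\<^sub>v (card I)"
      "\<forall>j\<in>{1..N}. restr n B *\<^sub>v u\<^sub>0 j = f\<^sub>0 j"
    and u\<^sub>1: "\<forall>j\<in>{1..N}. u\<^sub>1 j \<in> carrier_vec n"
      "\<forall>j\<in>{1..N}. restr n I *\<^sub>v (transpose_mat (grad n es) *\<^sub>v
           (conductivity \<omega>\<^sub>1 \<sigma>' \<sigma>'' \<odot>\<^sub>v (grad n es *\<^sub>v u\<^sub>1 j)))
         = 0\<^sub>v (card I)"
      "\<forall>j\<in>{1..N}. restr n B *\<^sub>v u\<^sub>1 j = f\<^sub>1 j"
    and a: "(\<Union>j\<in>{1..N}. supp (grad n es *\<^sub>v u\<^sub>0 j)) = {..<length es}"
    and b: "invertible_mat (submatrix (laplacian n es \<sigma>') I I)"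
    and c: "\<forall>j\<in>{1..N}. invertible_mat
         (submatrix (laplacian n es (sign_vec (grad n es *\<^sub>v u\<^sub>0 j) \<odot>\<^sub>v \<sigma>')) I I)"
    and full_rank: "vec_space.rank (N * length es)
         (map_mat Re (vstack (length es)
            (map (\<lambda>j. A_mat n es I (conductivity \<omega>\<^sub>1 \<sigma>' \<sigma>'') (u\<^sub>1 j)) [1..<N + 1])))
         = length es"
    and \<delta>\<sigma>: "\<delta>\<sigma>' \<in> carrier_vec (length es)" "\<delta>\<sigma>'' \<in> carrier_vec (length es)"
    and \<delta>u: "\<forall>j\<in>{1..N}. \<delta>u\<^sub>0 j \<in> carrier_vec n" "\<forall>j\<in>{1..N}. \<delta>u\<^sub>1 j \<in> carrier_vec n"
      "\<forall>j\<in>{1..N}. \<delta>u\<^sub>1_bar j \<in> carrier_vec n"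
    and data\<^sub>0: "\<forall>j\<in>{1..N}.
         \<delta>\<sigma>' \<odot>\<^sub>v abs_sq (grad n es *\<^sub>v u\<^sub>0 j)
         + 2 \<cdot>\<^sub>v (\<sigma>' \<odot>\<^sub>v (grad n es *\<^sub>v u\<^sub>0 j) \<odot>\<^sub>v (grad n es *\<^sub>v \<delta>u\<^sub>0 j))
         = 0\<^sub>v (length es)"
    and data\<^sub>1: "\<forall>j\<in>{1..N}.
         cvec \<delta>\<sigma>' \<odot>\<^sub>v cvec (abs_sq (grad n es *\<^sub>v u\<^sub>1 j))
         + cvec \<sigma>' \<odot>\<^sub>v cnj_vec (grad n es *\<^sub>v u\<^sub>1 j) \<odot>\<^sub>v (grad n es *\<^sub>v \<delta>u\<^sub>1 j)
         + cvec \<sigma>' \<odot>\<^sub>v (grad n es *\<^sub>v u\<^sub>1 j) \<odot>\<^sub>v (grad n es *\<^sub>v \<delta>u\<^sub>1_bar j)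
         = 0\<^sub>v (length es)"
    and dirichlet\<^sub>0: "\<forall>j\<in>{1..N}. restr n I *\<^sub>v
         (transpose_mat (grad n es) *\<^sub>v (\<delta>\<sigma>' \<odot>\<^sub>v (grad n es *\<^sub>v u\<^sub>0 j))
          + transpose_mat (grad n es) *\<^sub>v (\<sigma>' \<odot>\<^sub>v (grad n es *\<^sub>v \<delta>u\<^sub>0 j)))
         = 0\<^sub>v (card I)"
    and dirichlet\<^sub>1: "\<forall>j\<in>{1..N}. restr n I *\<^sub>v
         (transpose_mat (grad n es) *\<^sub>v
            (conductivity \<omega>\<^sub>1 \<delta>\<sigma>' \<delta>\<sigma>'' \<odot>\<^sub>v (grad n es *\<^sub>v u\<^sub>1 j))
          + transpose_mat (grad n es) *\<^sub>v
            (conductivity \<omega>\<^sub>1 \<sigma>' \<sigma>'' \<odot>\<^sub>v (grad n es *\<^sub>v \<delta>u\<^sub>1 j)))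
         = 0\<^sub>v (card I)"
    and dirichlet\<^sub>1_bar: "\<forall>j\<in>{1..N}. restr n I *\<^sub>v
         (transpose_mat (grad n es) *\<^sub>v
            (conductivity (- \<omega>\<^sub>1) \<delta>\<sigma>' \<delta>\<sigma>'' \<odot>\<^sub>v cnj_vec (grad n es *\<^sub>v u\<^sub>1 j))
          + transpose_mat (grad n es) *\<^sub>v
            (conductivity (- \<omega>\<^sub>1) \<sigma>' \<sigma>'' \<odot>\<^sub>v (grad n es *\<^sub>v \<delta>u\<^sub>1_bar j)))
         = 0\<^sub>v (card I)"
    and boundary: "\<forall>j\<in>{1..N}. restr n B *\<^sub>v \<delta>u\<^sub>0 j = 0\<^sub>v (card B)"
      "\<forall>j\<in>{1..N}. restr n B *\<^sub>v \<delta>u\<^sub>1 j = 0\<^sub>v (card B)"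
      "\<forall>j\<in>{1..N}. restr n B *\<^sub>v \<delta>u\<^sub>1_bar j = 0\<^sub>v (card B)"
  shows "\<delta>\<sigma>' = 0\<^sub>v (length es) \<and> \<delta>\<sigma>'' = 0\<^sub>v (length es)
    \<and> (\<forall>j\<in>{1..N}. \<delta>u\<^sub>0 j = 0\<^sub>v n \<and> \<delta>u\<^sub>1 j = 0\<^sub>v n \<and> \<delta>u\<^sub>1_bar j = 0\<^sub>v n)"
proof -
  have I: "I \<subseteq> {..<n}" using partition(1) by blast
  let ?\<tau> = "conductivity \<omega>\<^sub>1 \<sigma>' \<sigma>''"
  have \<tau>: "?\<tau> \<in> carrier_vec (length es)" using \<sigma>'' by (intro carrier_vecI) simp
  have uniq: "dirichlet_unique n es I ?\<tau>"
    using dirichlet_unique_conductivity[OF graph I \<sigma>' \<sigma>''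
        invertible_imp_dirichlet_unique[OF I \<sigma>'(1) b]] .
  have supported: "interior_supported n I (\<delta>u\<^sub>0 j)" "interior_supported n I (\<delta>u\<^sub>1 j)"
    "interior_supported n I (\<delta>u\<^sub>1_bar j)" if "j \<in> {1..N}" for j
    using that interior_supportedI[OF partition(1)] \<delta>u boundary by blast+

  have "net_current n es I (\<delta>\<sigma>' \<odot>\<^sub>v (grad n es *\<^sub>v u\<^sub>0 j) + \<sigma>' \<odot>\<^sub>v (grad n es *\<^sub>v \<delta>u\<^sub>0 j))
      = 0\<^sub>v (card I)" if "j \<in> {1..N}" for j
    using net_current_add[OF I hadamard_carrier[OF \<delta>\<sigma>(1)] hadamard_carrier[OF \<sigma>'(1)]]
      dirichlet\<^sub>0 that by metis
  then have static: "\<delta>u\<^sub>0 j = 0\<^sub>v n" "\<forall>k\<in>supp (grad n es *\<^sub>v u\<^sub>0 j). \<delta>\<sigma>' $ k = 0"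
    if "j \<in> {1..N}" for j
    using zero_frequency_injective[OF I \<sigma>'(1) \<delta>\<sigma>(1) supported(1)[OF that]] c data\<^sub>0 that by blast+
  have "\<delta>\<sigma>' $ k = 0" if "k < length es" for k
    using static(2) a that by blast
  then have \<delta>\<sigma>'0: "\<delta>\<sigma>' = 0\<^sub>v (length es)"
    using \<delta>\<sigma>(1) by (intro eq_vecI) simp_all

  let ?d = "(\<i> * complex_of_real \<omega>\<^sub>1) \<cdot>\<^sub>v cvec \<delta>\<sigma>''"
  have d: "conductivity \<omega>\<^sub>1 \<delta>\<sigma>' \<delta>\<sigma>'' = ?d"
    unfolding \<delta>\<sigma>'0 using \<delta>\<sigma>(2) by (intro eq_vecI) (simp_all add: conductivity_def)
  have cond_carrier: "conductivity \<omega> p q \<in> carrier_vec (length es)"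
    if "q \<in> carrier_vec (length es)" for \<omega> p q
    using that by (intro carrier_vecI) simp
  have eq: "net_current n es I (?d \<odot>\<^sub>v (grad n es *\<^sub>v u\<^sub>1 j) + ?\<tau> \<odot>\<^sub>v (grad n es *\<^sub>v \<delta>u\<^sub>1 j))
      = 0\<^sub>v (card I)" if "j \<in> {1..N}" for j
    using dirichlet\<^sub>1 that
      net_current_add[OF I hadamard_carrier[OF cond_carrier[OF \<delta>\<sigma>(2)]] hadamard_carrier[OF \<tau>]]
    unfolding d[symmetric] by metis
  have eq_bar: "net_current n es I (?d \<odot>\<^sub>v (grad n es *\<^sub>v u\<^sub>1 j)
      + ?\<tau> \<odot>\<^sub>v (grad n es *\<^sub>v cnj_vec (\<delta>u\<^sub>1_bar j))) = 0\<^sub>v (card I)" if "j \<in> {1..N}" for j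
    unfolding d[symmetric]
  proof (rule net_current_conjugate_equation[OF graph I \<sigma>'(1) \<sigma>'' \<delta>\<sigma>])
    show "\<delta>u\<^sub>1_bar j \<in> carrier_vec n" using \<delta>u(3) that by blast
    show "net_current n es I
        (conductivity (- \<omega>\<^sub>1) \<delta>\<sigma>' \<delta>\<sigma>'' \<odot>\<^sub>v cnj_vec (grad n es *\<^sub>v u\<^sub>1 j)
          + conductivity (- \<omega>\<^sub>1) \<sigma>' \<sigma>'' \<odot>\<^sub>v (grad n es *\<^sub>v \<delta>u\<^sub>1_bar j)) = 0\<^sub>v (card I)"
      using dirichlet\<^sub>1_bar that
        net_current_add[OF I hadamard_carrier[OF cond_carrier[OF \<delta>\<sigma>(2)]]
          hadamard_carrier[OF cond_carrier[OF \<sigma>'']]] by metis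
  qed
  have zero_term: "cvec (0\<^sub>v (length es)) \<odot>\<^sub>v w = 0\<^sub>v (length es)" for w
    by (intro eq_vecI) simp_all
  have kernel: "map_mat Re (A_mat n es I ?\<tau> (u\<^sub>1 j)) *\<^sub>v \<delta>\<sigma>'' = 0\<^sub>v (length es)"
    if j: "j \<in> {1..N}" for j
  proof (rule linearized_power_imp_Re_A_kernel[OF graph I \<sigma>' \<tau> uniq \<delta>\<sigma>(2) \<omega>\<^sub>1
        supported(2)[OF j] supported(3)[OF j] eq[OF j] eq_bar[OF j]])
    have "cvec \<sigma>' \<odot>\<^sub>v cnj_vec (grad n es *\<^sub>v u\<^sub>1 j) \<odot>\<^sub>v (grad n es *\<^sub>v \<delta>u\<^sub>1 j) \<in> carrier_vec (length es)"
      using \<sigma>'(1) by simp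
    then show "cvec \<sigma>' \<odot>\<^sub>v cnj_vec (grad n es *\<^sub>v u\<^sub>1 j) \<odot>\<^sub>v (grad n es *\<^sub>v \<delta>u\<^sub>1 j)
        + cvec \<sigma>' \<odot>\<^sub>v (grad n es *\<^sub>v u\<^sub>1 j) \<odot>\<^sub>v (grad n es *\<^sub>v \<delta>u\<^sub>1_bar j) = 0\<^sub>v (length es)"
      using bspec[OF data\<^sub>1 j] unfolding \<delta>\<sigma>'0 zero_term by (simp only: left_zero_vec)
  qed
  define Ms where "Ms = map (\<lambda>j. A_mat n es I ?\<tau> (u\<^sub>1 j)) [1..<N + 1]"
  have len: "length Ms = N" by (simp add: Ms_def)
  have Ms_carrier: "\<forall>M\<in>set Ms. M \<in> carrier_mat (length es) (length es)"
    by (auto simp: Ms_def A_mat_carrier)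
  have \<delta>\<sigma>''0: "\<delta>\<sigma>'' = 0\<^sub>v (length es)"
  proof (rule vec_space.full_column_rank_imp_trivial_kernel)
    show "map_mat Re (vstack (length es) Ms) \<in> carrier_mat (N * length es) (length es)"
      using vstack_carrier[OF Ms_carrier] len by simp
    show "vec_space.rank (N * length es) (map_mat Re (vstack (length es) Ms)) = length es"
      using full_rank unfolding Ms_def .
    show "\<delta>\<sigma>'' \<in> carrier_vec (length es)" by fact
    have "\<forall>M\<in>set Ms. map_mat Re M *\<^sub>v \<delta>\<sigma>'' = 0\<^sub>v (length es)"
      using kernel by (auto simp: Ms_def)
    then show "map_mat Re (vstack (length es) Ms) *\<^sub>v \<delta>\<sigma>'' = 0\<^sub>v (N * length es)"
      using vstack_kernel[OF Ms_carrier] len by simp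
  qed

  have d0: "?d = 0\<^sub>v (length es)"
    unfolding \<delta>\<sigma>''0 by (intro eq_vecI) simp_all
  have \<delta>u\<^sub>10: "\<delta>u\<^sub>1 j = 0\<^sub>v n" if "j \<in> {1..N}" for j
    using dirichlet_uniqueD[OF uniq \<tau> supported(2)] eq[unfolded d0] that by blast
  have \<delta>u\<^sub>1_bar0: "\<delta>u\<^sub>1_bar j = 0\<^sub>v n" if j: "j \<in> {1..N}" for j
  proof -
    have "cnj_vec (\<delta>u\<^sub>1_bar j) = 0\<^sub>v n"
      using dirichlet_uniqueD[OF uniq \<tau>
          interior_supported_map_vec[of n I "\<delta>u\<^sub>1_bar j" cnj, OF supported(3)[OF j]] eq_bar[OF j, unfolded d0]]
      by simp
    then show ?thesis by (auto simp: vec_eq_iff)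
  qed
  show ?thesis
    using \<delta>\<sigma>'0 \<delta>\<sigma>''0 static(1) \<delta>u\<^sub>10 \<delta>u\<^sub>1_bar0 by blast
qed

end
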